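(* Let $K$ be a field, $S=K[x_1,\ldots,x_n]$, and let $I\subset S$ be a monomial ideal minimally generated by two monomials $u_1,u_2\in S$. Then $$\operatorname{slength}(I)=\min\{\deg(u_1),\deg(u_2)\}-\deg(\gcd(u_1,u_2))+1.$$
   Context: Let $M$ be a finitely generated $\mathbb Z^n$-graded $S$-module, $S=K[x_1,\ldots,x_n]$. A Stanley decomposition of $M$ is a finite direct sum of $K$-vector spaces $\mathcal D: M=\bigoplus_{i=1}^r m_iK[Z_i]$, where each $m_i\in M$ is homogeneous, $Z_i\subset\{x_1,\ldots,x_n\}$, and $m_iK[Z_i]$ is a free $K[Z_i]$-module. Its length is $\operatorname{slength}(\mathcal D)=r$, and the Stanley length of $M$ is $\operatorname{slength}(M)=\min\{\operatorname{slength}(\mathcal D):\mathcal D\text{ is a Stanley decomposition of }M\}$. Here $\deg$ denotes total degree of a monomial. *)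

theory Defs
  imports "HOL.Modules" "HOL-Library.Poly_Mapping"
begin

section \<open>Polynomial rings and monomials\<close>

text \<open>The index type \<open>'n\<close> plays the role of \<open>{1, \<dots>, n}\<close>: a polynomial is a finitely supported
  function from exponent vectors \<open>'n \<Rightarrow>\<^sub>0 nat\<close> to coefficients, and \<open>Poly_Mapping.single a 1\<close> is
  the monomial with exponent vector \<open>a\<close>.\<close>

type_synonym ('n, 'k) mpoly = "('n \<Rightarrow>\<^sub>0 nat) \<Rightarrow>\<^sub>0 'k"

definition is_monomial :: "('n, 'k::field) mpoly \<Rightarrow> bool" where
  "is_monomial u \<longleftrightarrow> (\<exists>a. u = Poly_Mapping.single a 1)"

definition total_degree :: "('n::finite, 'k::field) mpoly \<Rightarrow> nat" where
  "total_degree p = Max (insert 0 ((\<lambda>a. \<Sum>i\<in>UNIV. Poly_Mapping.lookup a i) ` Poly_Mapping.keys p))"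

text \<open>A greatest common divisor in \<open>S\<close> is determined up to a nonzero constant; for monomials it is
  normalised to be a monomial (coefficient 1).\<close>

definition monomial_gcd :: "('n::finite, 'k::field) mpoly \<Rightarrow> ('n, 'k) mpoly \<Rightarrow> ('n, 'k) mpoly" where
  "monomial_gcd u v =
     (THE g. is_monomial g \<and> g dvd u \<and> g dvd v \<and> (\<forall>h. h dvd u \<and> h dvd v \<longrightarrow> h dvd g))"

text \<open>\<open>K[Z]\<close> for a set \<open>Z\<close> of variables, as a subring of \<open>S\<close>.\<close>

definition polys_in :: "'n set \<Rightarrow> ('n, 'k::field) mpoly set" where
  "polys_in Z = {p. \<forall>a\<in>Poly_Mapping.keys p. Poly_Mapping.keys a \<subseteq> Z}"


section \<open>Direct sums and free modules\<close>

text \<open>\<open>M\<close> is the internal direct sum of the additive subgroups \<open>N j\<close> for \<open>j \<in> J\<close>.\<close>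

definition internal_direct_sum ::
    "'m::ab_group_add set \<Rightarrow> 'j set \<Rightarrow> ('j \<Rightarrow> 'm set) \<Rightarrow> bool" where
  "internal_direct_sum M J N \<longleftrightarrow>
     M = {\<Sum>j\<in>F. v j | F v. finite F \<and> F \<subseteq> J \<and> (\<forall>j\<in>F. v j \<in> N j)} \<and>
     (\<forall>F v. finite F \<and> F \<subseteq> J \<and> (\<forall>j\<in>F. v j \<in> N j) \<and> (\<Sum>j\<in>F. v j) = 0 \<longrightarrow> (\<forall>j\<in>F. v j = 0))"

text \<open>\<open>N\<close> is a free module over the subring \<open>R\<close> of the scalars, i.e. it has an \<open>R\<close>-basis.\<close>

definition free_over ::
    "('s::comm_ring_1 \<Rightarrow> 'm::ab_group_add \<Rightarrow> 'm) \<Rightarrow> 's set \<Rightarrow> 'm set \<Rightarrow> bool" where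
  "free_over scale R N \<longleftrightarrow> (\<exists>B.
     N = {\<Sum>b\<in>T. scale (c b) b | T c. finite T \<and> T \<subseteq> B \<and> (\<forall>b\<in>T. c b \<in> R)} \<and>
     (\<forall>T c. finite T \<and> T \<subseteq> B \<and> (\<forall>b\<in>T. c b \<in> R) \<and> (\<Sum>b\<in>T. scale (c b) b) = 0
        \<longrightarrow> (\<forall>b\<in>T. c b = 0)))"


section \<open>Finitely generated multigraded modules and Stanley decompositions\<close>

text \<open>\<open>M\<close> is a finitely generated \<open>\<int>\<^sup>n\<close>-graded \<open>S\<close>-module, realised as a submodule of an ambient
  \<open>S\<close>-module; \<open>comp a\<close> is its component of degree \<open>a \<in> \<int>\<^sup>n\<close>.\<close>

locale fg_multigraded_module = module scale
  for scale :: "('n::finite, 'k::field) mpoly \<Rightarrow> 'm::ab_group_add \<Rightarrow> 'm" +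
  fixes M :: "'m set" and comp :: "('n \<Rightarrow> int) \<Rightarrow> 'm set"
  assumes submodule: "subspace M"
    and finitely_generated: "\<exists>G. finite G \<and> span G = M"
    and comp_zero: "0 \<in> comp a"
    and comp_add: "x \<in> comp a \<Longrightarrow> y \<in> comp a \<Longrightarrow> x + y \<in> comp a"
    and comp_uminus: "x \<in> comp a \<Longrightarrow> - x \<in> comp a"
    and comp_scale: "x \<in> comp a \<Longrightarrow>
      scale (Poly_Mapping.single b c) x \<in> comp (\<lambda>i. a i + int (Poly_Mapping.lookup b i))"
    and comp_direct_sum: "internal_direct_sum M UNIV comp"
begin

definition stanley_space :: "'m \<Rightarrow> 'n set \<Rightarrow> 'm set" where
  "stanley_space m Z = (\<lambda>p. scale p m) ` polys_in Z"

text \<open>The list \<open>[(m\<^sub>1, Z\<^sub>1), \<dots>, (m\<^sub>r, Z\<^sub>r)]\<close> stands for \<open>M = m\<^sub>1K[Z\<^sub>1] \<oplus> \<dots> \<oplus> m\<^sub>rK[Z\<^sub>r]\<close>.\<close>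

definition stanley_decomposition :: "('m \<times> 'n set) list \<Rightarrow> bool" where
  "stanley_decomposition D \<longleftrightarrow>
     (\<forall>(m, Z)\<in>set D. m \<in> M \<and> (\<exists>a. m \<in> comp a) \<and> free_over scale (polys_in Z) (stanley_space m Z)) \<and>
     internal_direct_sum M {..<length D} (\<lambda>i. stanley_space (fst (D ! i)) (snd (D ! i)))"

text \<open>The infimum in \<open>nat\<close> is a minimum when a decomposition exists, and \<open>0\<close> otherwise.\<close>

definition slength :: nat where
  "slength = Inf {length D | D. stanley_decomposition D}"

end


section \<open>Monomial ideals\<close>

interpretation ideal: module "(*) :: 'a::comm_ring_1 \<Rightarrow> 'a \<Rightarrow> 'a"
  by unfold_locales (simp_all add: algebra_simps)

definition monomial_ideal :: "('n, 'k::field) mpoly set \<Rightarrow> bool" where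
  "monomial_ideal I \<longleftrightarrow> (\<exists>G. (\<forall>u\<in>G. is_monomial u) \<and> I = ideal.span G)"

definition minimally_generates :: "'a::comm_ring_1 set \<Rightarrow> 'a set \<Rightarrow> bool" where
  "minimally_generates G I \<longleftrightarrow> ideal.span G = I \<and> (\<forall>H. H \<subset> G \<longrightarrow> ideal.span H \<noteq> I)"

text \<open>The \<open>\<int>\<^sup>n\<close>-grading that a monomial ideal inherits from \<open>S\<close>.\<close>

definition ideal_comp :: "('n, 'k::field) mpoly set \<Rightarrow> ('n \<Rightarrow> int) \<Rightarrow> ('n, 'k) mpoly set" where
  "ideal_comp I a = {p \<in> I. \<forall>b\<in>Poly_Mapping.keys p. (\<lambda>i. int (Poly_Mapping.lookup b i)) = a}"

abbreviation ideal_slength :: "('n::finite, 'k::field) mpoly set \<Rightarrow> nat" where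
  "ideal_slength I \<equiv> fg_multigraded_module.slength (*) I (ideal_comp I)"


section \<open>Monomial ideals are multigraded modules\<close>

lemma lookup_times_single:
  fixes r :: "('n, 'k::field) mpoly"
  shows "Poly_Mapping.lookup (r * Poly_Mapping.single a 1) b = (\<Sum>l. Poly_Mapping.lookup r l when b = l + a)"
proof -
  have "(\<Sum>q. Poly_Mapping.lookup (Poly_Mapping.single a (1::'k)) q when b = l + q) = (1 when b = l + a)" for l
  proof -
    have "(Poly_Mapping.lookup (Poly_Mapping.single a (1::'k)) q when b = l + q) = ((1 when b = l + a) when a = q)" for q
      by (auto simp: lookup_single when_def)
    then show ?thesis by simp
  qed
  then show ?thesis by (simp add: lookup_mult mult_when)
qed

lemma term_times_single:
  fixes r :: "('n, 'k::field) mpoly"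
  shows "\<exists>q. Poly_Mapping.single b (Poly_Mapping.lookup (r * Poly_Mapping.single a 1) b)
           = q * Poly_Mapping.single a 1"
proof (cases "\<exists>c. b = c + a")
  case True
  then obtain c where "b = c + a" ..
  then have "Poly_Mapping.single b (Poly_Mapping.lookup (r * Poly_Mapping.single a 1) b)
           = Poly_Mapping.single c (Poly_Mapping.lookup r c) * Poly_Mapping.single a 1"
    by (simp add: lookup_times_single mult_single)
  then show ?thesis by blast
next
  case False
  then have "Poly_Mapping.lookup (r * Poly_Mapping.single a 1) b = 0"
    by (simp add: lookup_times_single)
  then show ?thesis by (intro exI[of _ 0]) simp
qed

lemma term_in_monomial_ideal:
  assumes "monomial_ideal I" "p \<in> I"
  shows "Poly_Mapping.single b (Poly_Mapping.lookup p b) \<in> I"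
proof -
  obtain G where G: "\<forall>u\<in>G. is_monomial u" "I = ideal.span G"
    using assms(1) by (auto simp: monomial_ideal_def)
  have "p \<in> ideal.span G" using assms(2) G(2) by simp
  then have "Poly_Mapping.single b (Poly_Mapping.lookup p b) \<in> ideal.span G"
  proof (induction rule: ideal.span_induct_alt)
    case base
    then show ?case by (simp add: ideal.span_zero)
  next
    case (step c x y)
    then obtain a where "x = Poly_Mapping.single a 1"
      using G(1) by (auto simp: is_monomial_def)
    then obtain q where "Poly_Mapping.single b (Poly_Mapping.lookup (c * x) b) = q * x"
      using term_times_single by blast
    then show ?case
      using step by (simp add: lookup_add single_add ideal.span_add ideal.span_scale ideal.span_base)
  qed
  then show ?thesis using G(2) by simp
qed

lemma poly_eq_sum_terms: "p = (\<Sum>b\<in>Poly_Mapping.keys p. Poly_Mapping.single b (Poly_Mapping.lookup p b))"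
  by (rule poly_mapping_eqI) (auto simp: lookup_sum lookup_single when_def in_keys_iff)

theorem monomial_ideal_multigraded:
  fixes I :: "('n::finite, 'k::field) mpoly set"
  assumes "monomial_ideal I" "finite G" "ideal.span G = I"
  shows "fg_multigraded_module (*) I (ideal_comp I)"
proof
  have I: "ideal.subspace I" using assms(3) by auto
  show "ideal.subspace I" by (fact I)
  show "\<exists>G. finite G \<and> ideal.span G = I" using assms by auto
  show "0 \<in> ideal_comp I a" for a
    using I by (simp add: ideal_comp_def ideal.subspace_0)
  show "x + y \<in> ideal_comp I a" if "x \<in> ideal_comp I a" "y \<in> ideal_comp I a" for x y a
    using that I Poly_Mapping.keys_add[of x y] by (auto simp: ideal_comp_def ideal.subspace_add)
  show "- x \<in> ideal_comp I a" if "x \<in> ideal_comp I a" for x a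
    using that I by (auto simp: ideal_comp_def ideal.subspace_neg in_keys_iff)
  show "Poly_Mapping.single b c * x \<in> ideal_comp I (\<lambda>i. a i + int (Poly_Mapping.lookup b i))"
    if "x \<in> ideal_comp I a" for x a b c
    using that I keys_mult[of "Poly_Mapping.single b c" x]
    by (fastforce simp: ideal_comp_def ideal.subspace_scale lookup_add split: if_splits)
  define e where "e = (\<lambda>(b :: 'n \<Rightarrow>\<^sub>0 nat) i. int (Poly_Mapping.lookup b i))"
  have inj: "inj e" by (auto intro!: injI poly_mapping_eqI simp: e_def fun_eq_iff)
  have comp: "ideal_comp I a = {p \<in> I. \<forall>b\<in>Poly_Mapping.keys p. e b = a}" for a
    by (simp add: ideal_comp_def e_def)
  show "internal_direct_sum I UNIV (ideal_comp I)"
    unfolding internal_direct_sum_def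
  proof (intro conjI set_eqI iffI allI impI ballI)
    fix p assume p: "p \<in> I"
    define v where "v = (\<lambda>a. Poly_Mapping.single (inv e a) (Poly_Mapping.lookup p (inv e a)))"
    have "p = (\<Sum>a\<in>e ` Poly_Mapping.keys p. v a)"
      using poly_eq_sum_terms[of p] inj by (simp add: sum.reindex inj_on_subset v_def)
    moreover have "\<forall>a\<in>e ` Poly_Mapping.keys p. v a \<in> ideal_comp I a"
      using inj term_in_monomial_ideal[OF assms(1) p] by (auto simp: comp v_def split: if_splits)
    ultimately show "p \<in> {\<Sum>j\<in>F. v j |F v. finite F \<and> F \<subseteq> UNIV \<and> (\<forall>j\<in>F. v j \<in> ideal_comp I j)}"
      by (auto intro!: exI[of _ "e ` Poly_Mapping.keys p"] exI[of _ v])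
  next
    fix p assume "p \<in> {\<Sum>j\<in>F. v j |F v. finite F \<and> F \<subseteq> UNIV \<and> (\<forall>j\<in>F. v j \<in> ideal_comp I j)}"
    then show "p \<in> I" using I by (auto simp: comp intro!: ideal.subspace_sum)
  next
    fix F v a
    assume *: "finite F \<and> F \<subseteq> UNIV \<and> (\<forall>j\<in>F. v j \<in> ideal_comp I j) \<and> sum v F = 0" and a: "a \<in> F"
    show "v a = 0"
    proof (rule ccontr)
      assume "v a \<noteq> 0"
      then obtain b where b: "Poly_Mapping.lookup (v a) b \<noteq> 0" by (metis poly_mapping_eqI lookup_zero)
      have "Poly_Mapping.lookup (v j) b = 0" if "j \<in> F" "j \<noteq> a" for j
        using * that a b by (metis (mono_tags, lifting) comp in_keys_iff mem_Collect_eq)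
      then have "(\<Sum>j\<in>F - {a}. Poly_Mapping.lookup (v j) b) = 0"
        by (intro sum.neutral) auto
      then have "Poly_Mapping.lookup (sum v F) b = Poly_Mapping.lookup (v a) b"
        using * a sum.remove[of F a "\<lambda>j. Poly_Mapping.lookup (v j) b"]
        unfolding lookup_sum by (metis add.right_neutral)
      then show False using * b by simp
    qed
  qed
qed

lemma monomial_dvd_iff:
  fixes a b :: "'n \<Rightarrow>\<^sub>0 nat"
  shows "Poly_Mapping.single a (1::'k::field) dvd Poly_Mapping.single b 1 \<longleftrightarrow>
    (\<forall>i. Poly_Mapping.lookup a i \<le> Poly_Mapping.lookup b i)"
proof
  assume "Poly_Mapping.single a (1::'k) dvd Poly_Mapping.single b 1"
  then obtain q where "Poly_Mapping.single b (1::'k) = q * Poly_Mapping.single a 1"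
    by (metis dvd_def mult.commute)
  then have "b \<in> Poly_Mapping.keys (q * Poly_Mapping.single a 1)" by (metis keys_single insertI1 zero_neq_one)
  then obtain c where "b = c + a"
    using keys_mult[of q "Poly_Mapping.single a 1"] by auto
  then show "\<forall>i. Poly_Mapping.lookup a i \<le> Poly_Mapping.lookup b i"
    by (simp add: lookup_add)
next
  assume "\<forall>i. Poly_Mapping.lookup a i \<le> Poly_Mapping.lookup b i"
  then have "b = a + (b - a)" by (intro poly_mapping_eqI) (simp add: lookup_add lookup_minus)
  then have "Poly_Mapping.single b (1::'k) = Poly_Mapping.single a 1 * Poly_Mapping.single (b - a) 1"
    by (simp add: mult_single)
  then show "Poly_Mapping.single a (1::'k) dvd Poly_Mapping.single b 1" by (rule dvdI)
qed

lemma digits_unique: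
  fixes B :: nat
  assumes "\<forall>k<n. d k < B" "\<forall>k<n. e k < B" "(\<Sum>k<n. d k * B ^ k) = (\<Sum>k<n. e k * B ^ k)"
  shows "\<forall>k<n. d k = e k"
  using assms
proof (induction n arbitrary: d e)
  case (Suc n)
  have *: "(\<Sum>k<Suc n. f k * B ^ k) = f 0 + B * (\<Sum>k<n. f (Suc k) * B ^ k)" for f :: "nat \<Rightarrow> nat"
    by (simp add: sum.lessThan_Suc_shift sum_distrib_left algebra_simps del: sum.lessThan_Suc)
  have B: "d 0 < B" "e 0 < B" using Suc.prems by auto
  have eq: "d 0 + B * (\<Sum>k<n. d (Suc k) * B ^ k) = e 0 + B * (\<Sum>k<n. e (Suc k) * B ^ k)"
    using Suc.prems(3) unfolding * .
  then have 0: "d 0 = e 0" using B by (metis mod_less mod_mult_self2)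
  with eq B have "(\<Sum>k<n. d (Suc k) * B ^ k) = (\<Sum>k<n. e (Suc k) * B ^ k)" by simp
  then have "\<forall>k<n. d (Suc k) = e (Suc k)"
    using Suc.prems by (intro Suc.IH[of "\<lambda>k. d (Suc k)" "\<lambda>k. e (Suc k)"]) auto
  with 0 show ?case by (auto simp: less_Suc_eq_0_disj)
qed simp

lemma additive_weight:
  fixes A :: "('n::finite \<Rightarrow>\<^sub>0 nat) set"
  assumes "finite A"
  shows "\<exists>w::('n \<Rightarrow>\<^sub>0 nat) \<Rightarrow> nat. (\<forall>a b. w (a + b) = w a + w b) \<and> inj_on w A"
proof -
  obtain s :: "nat \<Rightarrow> 'n" where s: "bij_betw s {..<card (UNIV :: 'n set)} UNIV"
    using ex_bij_betw_nat_finite[of "UNIV :: 'n set"] by (auto simp: atLeast0LessThan)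
  define B where "B = Suc (\<Sum>a\<in>A. \<Sum>i\<in>UNIV. Poly_Mapping.lookup a i)"
  have B: "Poly_Mapping.lookup a i < B" if "a \<in> A" for a i
  proof -
    have "Poly_Mapping.lookup a i \<le> (\<Sum>i\<in>UNIV. Poly_Mapping.lookup a i)" by (rule member_le_sum) auto
    also have "\<dots> \<le> (\<Sum>a\<in>A. \<Sum>i\<in>UNIV. Poly_Mapping.lookup a i)"
      using that assms by (intro member_le_sum) auto
    finally show ?thesis by (simp add: B_def)
  qed
  define w where "w = (\<lambda>a::'n \<Rightarrow>\<^sub>0 nat. \<Sum>k<card (UNIV :: 'n set). Poly_Mapping.lookup a (s k) * B ^ k)"
  have "w (a + b) = w a + w b" for a b
    by (simp add: w_def lookup_add sum.distrib add_mult_distrib)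
  moreover have "inj_on w A"
  proof (rule inj_onI)
    fix a b assume "a \<in> A" "b \<in> A" "w a = w b"
    then have *: "\<forall>k<card (UNIV :: 'n set). Poly_Mapping.lookup a (s k) = Poly_Mapping.lookup b (s k)"
      unfolding w_def using B by (intro digits_unique[where B = B]) auto
    have "Poly_Mapping.lookup a i = Poly_Mapping.lookup b i" for i
    proof -
      obtain k where "k < card (UNIV :: 'n set)" "s k = i"
        using s by (metis UNIV_I bij_betw_imp_surj_on imageE lessThan_iff)
      with * show ?thesis by auto
    qed
    then show "a = b" by (rule poly_mapping_eqI)
  qed
  ultimately show ?thesis by blast
qed

lemma lookup_mult_unique:
  fixes h q :: "('n, 'k::field) mpoly"
  assumes "\<And>x y. x \<in> Poly_Mapping.keys h \<Longrightarrow> y \<in> Poly_Mapping.keys q \<Longrightarrow> x + y = x0 + y0 \<Longrightarrow> x = x0 \<and> y = y0"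
  shows "Poly_Mapping.lookup (h * q) (x0 + y0) = Poly_Mapping.lookup h x0 * Poly_Mapping.lookup q y0"
proof -
  have "Poly_Mapping.lookup h l * (\<Sum>y. Poly_Mapping.lookup q y when x0 + y0 = l + y) = (Poly_Mapping.lookup h l * Poly_Mapping.lookup q y0 when x0 = l)" for l
  proof (cases "l \<in> Poly_Mapping.keys h")
    case True
    have "(Poly_Mapping.lookup q y when x0 + y0 = l + y) = ((Poly_Mapping.lookup q y0 when x0 = l) when y0 = y)" for y
      using assms[OF True, of y] by (cases "y \<in> Poly_Mapping.keys q") (auto simp: when_def in_keys_iff)
    then show ?thesis by (simp add: mult_when)
  qed (simp add: in_keys_iff)
  then show ?thesis by (simp add: lookup_mult)
qed

lemma dvd_monomial:
  fixes h :: "('n::finite, 'k::field) mpoly"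
  assumes "h dvd Poly_Mapping.single a 1"
  shows "\<exists>p c. h = Poly_Mapping.single p c \<and> c \<noteq> 0"
proof -
  obtain q where q: "h * q = Poly_Mapping.single a 1" using assms by (metis dvd_def)
  have ne: "h \<noteq> 0" "q \<noteq> 0" using q by (metis keys_single keys_zero mult_zero_left mult_zero_right
        insert_not_empty zero_neq_one)+
  obtain w where w: "\<And>a b :: 'n \<Rightarrow>\<^sub>0 nat. w (a + b) = w a + (w b :: nat)"
    "inj_on w (Poly_Mapping.keys h \<union> Poly_Mapping.keys q)"
    using additive_weight[of "Poly_Mapping.keys h \<union> Poly_Mapping.keys q"] by auto
  have nk: "Poly_Mapping.keys h \<noteq> {}" "Poly_Mapping.keys q \<noteq> {}" using ne by (metis poly_mapping_eqI lookup_zero in_keys_iff empty_iff)+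
  have fin: "finite (w ` Poly_Mapping.keys h)" "finite (w ` Poly_Mapping.keys q)" by auto
  have key: "x + y = a" if "x \<in> Poly_Mapping.keys h" "y \<in> Poly_Mapping.keys q"
    "\<And>x' y'. x' \<in> Poly_Mapping.keys h \<Longrightarrow> y' \<in> Poly_Mapping.keys q \<Longrightarrow> w x' + w y' = w x + w y \<Longrightarrow> w x' = w x \<and> w y' = w y" for x y
  proof -
    have "Poly_Mapping.lookup (h * q) (x + y) = Poly_Mapping.lookup h x * Poly_Mapping.lookup q y"
    proof (rule lookup_mult_unique)
      fix x' y' assume "x' \<in> Poly_Mapping.keys h" "y' \<in> Poly_Mapping.keys q" "x' + y' = x + y"
      moreover from this have "w x' = w x \<and> w y' = w y" using that(3) w(1) by metis
      ultimately show "x' = x \<and> y' = y" using that(1,2) w(2) by (auto dest: inj_onD)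
    qed
    then have "Poly_Mapping.lookup (h * q) (x + y) \<noteq> 0" using that(1,2) by (simp add: in_keys_iff)
    then show ?thesis unfolding q by (auto simp: lookup_single when_def split: if_splits)
  qed
  obtain x0 where x0: "x0 \<in> Poly_Mapping.keys h" "w x0 = Max (w ` Poly_Mapping.keys h)"
    using Max_in[OF fin(1)] nk by fastforce
  obtain y0 where y0: "y0 \<in> Poly_Mapping.keys q" "w y0 = Max (w ` Poly_Mapping.keys q)"
    using Max_in[OF fin(2)] nk by fastforce
  obtain x1 where x1: "x1 \<in> Poly_Mapping.keys h" "w x1 = Min (w ` Poly_Mapping.keys h)"
    using Min_in[OF fin(1)] nk by fastforce
  obtain y1 where y1: "y1 \<in> Poly_Mapping.keys q" "w y1 = Min (w ` Poly_Mapping.keys q)"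
    using Min_in[OF fin(2)] nk by fastforce
  have bounds: "w x1 \<le> w x" "w x \<le> w x0" if "x \<in> Poly_Mapping.keys h" for x
    using that x0 x1 fin by auto
  have bounds': "w y1 \<le> w y" "w y \<le> w y0" if "y \<in> Poly_Mapping.keys q" for y
    using that y0 y1 fin by auto
  have "x0 + y0 = a"
    by (rule key[OF x0(1) y0(1)]) (use bounds bounds' in fastforce)
  moreover have "x1 + y1 = a"
    by (rule key[OF x1(1) y1(1)]) (use bounds bounds' in fastforce)
  ultimately have "w x0 + w y0 = w x1 + w y1" by (metis w(1))
  then have "w x0 = w x1" using bounds[OF x0(1)] bounds'[OF y0(1)] by linarith
  then have "w x = w x0" if "x \<in> Poly_Mapping.keys h" for x using bounds[OF that] by linarith
  then have "Poly_Mapping.keys h = {x0}" using x0(1) w(2) by (auto dest: inj_onD)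
  then have "h = Poly_Mapping.single x0 (Poly_Mapping.lookup h x0)" using poly_eq_sum_terms[of h] by simp
  moreover have "Poly_Mapping.lookup h x0 \<noteq> 0" using x0(1) by (simp add: in_keys_iff)
  ultimately show ?thesis by blast
qed

theorem monomial_gcd_single:
  fixes a b g :: "'n::finite \<Rightarrow>\<^sub>0 nat"
  assumes g: "\<And>i. Poly_Mapping.lookup g i = min (Poly_Mapping.lookup a i) (Poly_Mapping.lookup b i)"
  shows "monomial_gcd (Poly_Mapping.single a (1::'k::field)) (Poly_Mapping.single b 1)
    = Poly_Mapping.single g 1"
  unfolding monomial_gcd_def
proof (rule the_equality)
  have "h dvd Poly_Mapping.single g 1"
    if h: "h dvd Poly_Mapping.single a (1::'k)" "h dvd Poly_Mapping.single b 1" for h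
  proof -
    obtain p c where p: "h = Poly_Mapping.single p c" "c \<noteq> 0" using dvd_monomial[OF h(1)] by blast
    have 1: "Poly_Mapping.single p 1 = h * Poly_Mapping.single 0 (inverse c)"
      and 2: "h = Poly_Mapping.single p 1 * Poly_Mapping.single 0 c"
      using p by (simp_all add: mult_single)
    have "Poly_Mapping.single p 1 dvd Poly_Mapping.single a (1::'k)"
      "Poly_Mapping.single p 1 dvd Poly_Mapping.single b (1::'k)"
      using h 2 by (metis dvd_mult_left)+
    then have "Poly_Mapping.single p 1 dvd Poly_Mapping.single g (1::'k)"
      by (simp add: monomial_dvd_iff g)
    then show ?thesis unfolding 1 by (rule dvd_mult_left)
  qed
  then show *: "is_monomial (Poly_Mapping.single g (1::'k)) \<and>
      Poly_Mapping.single g (1::'k) dvd Poly_Mapping.single a 1 \<and>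
      Poly_Mapping.single g (1::'k) dvd Poly_Mapping.single b 1 \<and>
      (\<forall>h. h dvd Poly_Mapping.single a (1::'k) \<and> h dvd Poly_Mapping.single b 1
        \<longrightarrow> h dvd Poly_Mapping.single g 1)"
    by (auto simp: is_monomial_def monomial_dvd_iff g)
  fix h
  assume h: "is_monomial h \<and> h dvd Poly_Mapping.single a (1::'k) \<and> h dvd Poly_Mapping.single b 1 \<and>
      (\<forall>h'. h' dvd Poly_Mapping.single a (1::'k) \<and> h' dvd Poly_Mapping.single b 1 \<longrightarrow> h' dvd h)"
  then obtain p where p: "h = Poly_Mapping.single p 1" by (auto simp: is_monomial_def)
  have "h dvd Poly_Mapping.single g 1" "Poly_Mapping.single g 1 dvd h" using h * by blast+
  then have "p = g" unfolding p monomial_dvd_iff by (intro poly_mapping_eqI) (simp add: eq_iff)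
  then show "h = Poly_Mapping.single g 1" using p by simp
qed

end

theory Submission
  imports Defs "HOL-Library.Disjoint_Sets"
begin

text \<open>Every graded component of \<open>I\<close> is at most one-dimensional, so a Stanley decomposition is a
  partition of the exponent vectors of \<open>I\<close> into boxes \<open>a + \<nat>\<^sup>Z\<close>. Write \<open>g\<close> for the exponent
  vector of the gcd.

  Upper bound: the multiples of \<open>u\<^sub>1\<close> form one box, and a chain of monomials from \<open>u\<^sub>2\<close> to the lcm
  that multiplies by one variable at a time cuts the remaining monomials of \<open>I\<close> into
  \<open>deg u\<^sub>1 - deg g\<close> boxes of codimension one.

  Lower bound: the monomial with a huge exponent everywhere lies in a box with \<open>Z\<close> the set of all
  variables; let \<open>h\<close> be its apex. For \<open>g\<^sub>i \<le> k < h\<^sub>i\<close>, the monomial with exponent \<open>k\<close> at \<open>i\<close> and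
  huge exponents elsewhere lies in \<open>I\<close>, and its box determines \<open>(i, k)\<close>. This gives
  \<open>deg h - deg g\<close> further boxes, and \<open>h \<in> I\<close> has degree at least \<open>min (deg u\<^sub>1) (deg u\<^sub>2)\<close>.\<close>

section \<open>Boxes of exponent vectors\<close>

text \<open>The set a + N^Z of exponents of the monomials in x^a K[Z], written coordinatewise so
  that inclusion and disjointness can be checked one variable at a time.\<close>

definition box :: "('n \<Rightarrow>\<^sub>0 nat) \<Rightarrow> 'n set \<Rightarrow> ('n \<Rightarrow>\<^sub>0 nat) set" where
  "box a Z = {b. \<forall>i. Poly_Mapping.lookup a i \<le> Poly_Mapping.lookup b i \<and>
     (i \<notin> Z \<longrightarrow> Poly_Mapping.lookup b i = Poly_Mapping.lookup a i)}"

definition deg :: "('n::finite \<Rightarrow>\<^sub>0 nat) \<Rightarrow> nat" where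
  "deg a = (\<Sum>i\<in>UNIV. Poly_Mapping.lookup a i)"

lemma box_iff_add: "b \<in> box a Z \<longleftrightarrow> (\<exists>c. Poly_Mapping.keys c \<subseteq> Z \<and> b = c + a)"
proof
  assume b: "b \<in> box a Z"
  then have "b = (b - a) + a"
    by (intro poly_mapping_eqI) (simp add: box_def lookup_add lookup_minus)
  moreover have "Poly_Mapping.keys (b - a) \<subseteq> Z"
    using b by (force simp: box_def in_keys_iff lookup_minus)
  ultimately show "\<exists>c. Poly_Mapping.keys c \<subseteq> Z \<and> b = c + a" by blast
qed (auto simp: box_def lookup_add in_keys_iff)

lemma apex_in_box: "a \<in> box a Z"
  by (simp add: box_def)

lemma deg_add: "deg (a + b) = deg a + deg b"
  by (simp add: deg_def lookup_add sum.distrib)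

lemma deg_single: "deg (Poly_Mapping.single i k) = k"
  by (simp add: deg_def lookup_single when_def)

lemma deg_mono: "b \<in> box a Z \<Longrightarrow> deg a \<le> deg b"
  by (auto simp: deg_def box_def intro: sum_mono)

lemma exponent_exists:
  fixes f :: "'n::finite \<Rightarrow> nat"
  shows "\<exists>a. \<forall>i. Poly_Mapping.lookup a i = f i"
  by (rule exI[of _ "Abs_poly_mapping f"]) (simp add: Abs_poly_mapping_inverse)

text \<open>Adding one unit vector at a time leads from \<open>d\<close> to \<open>d + e\<close>; each step splits off one box of
  codimension one.\<close>

lemma box_difference_partition:
  fixes d e :: "'n::finite \<Rightarrow>\<^sub>0 nat"
  shows "\<exists>L. length L = deg e \<and>
    (\<Union>j<length L. box (fst (L ! j)) (snd (L ! j))) = box d UNIV - box (d + e) UNIV \<and>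
    disjoint_family_on (\<lambda>j. box (fst (L ! j)) (snd (L ! j))) {..<length L}"
proof (induction "deg e" arbitrary: e)
  case 0
  then have "e = 0" by (intro poly_mapping_eqI) (simp add: deg_def)
  then show ?case using 0 by (simp add: disjoint_family_on_def)
next
  case (Suc n)
  then have "deg e \<noteq> 0" by simp
  then obtain i where i: "Poly_Mapping.lookup e i \<noteq> 0" by (auto simp: deg_def)
  define e' where "e' = e - Poly_Mapping.single i 1"
  have e: "e = e' + Poly_Mapping.single i 1"
    using i by (intro poly_mapping_eqI) (auto simp: e'_def lookup_add lookup_minus lookup_single when_def)
  then have "deg e' = n" using Suc(2) by (simp add: deg_add deg_single)
  then obtain L where L: "length L = n"
    "(\<Union>j<length L. box (fst (L ! j)) (snd (L ! j))) = box d UNIV - box (d + e') UNIV"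
    "disjoint_family_on (\<lambda>j. box (fst (L ! j)) (snd (L ! j))) {..<length L}"
    using Suc(1)[of e'] by auto
  \<comment> \<open>The new box keeps coordinate \<open>i\<close> at its least value; once this
    coordinate grows by one, the exponent lies in \<open>box (d + e) UNIV\<close>.\<close>
  let ?L = "(d + e', - {i}) # L"
  have de: "Poly_Mapping.lookup (d + e) j = Poly_Mapping.lookup (d + e') j + (if j = i then 1 else 0)" for j
    by (simp add: e lookup_add lookup_single when_def)
  have step: "box (d + e') UNIV = box (d + e') (- {i}) \<union> box (d + e) UNIV"
  proof (intro equalityI subsetI)
    fix b assume b: "b \<in> box (d + e') UNIV"
    show "b \<in> box (d + e') (- {i}) \<union> box (d + e) UNIV"
    proof (cases "Poly_Mapping.lookup b i = Poly_Mapping.lookup (d + e') i")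
      case True
      then show ?thesis using b by (simp add: box_def)
    next
      case False
      then have "Poly_Mapping.lookup (d + e) j \<le> Poly_Mapping.lookup b j" for j
        using b by (auto simp: box_def de Suc_le_eq le_neq_implies_less)
      then show ?thesis by (simp add: box_def)
    qed
  next
    fix b assume "b \<in> box (d + e') (- {i}) \<union> box (d + e) UNIV"
    then show "b \<in> box (d + e') UNIV" by (auto simp: box_def de intro: add_leD1)
  qed
  have disj: "box (d + e') (- {i}) \<inter> box (d + e) UNIV = {}"
  proof -
    have "\<not> Poly_Mapping.lookup (d + e) i \<le> Poly_Mapping.lookup (d + e') i" by (simp add: de)
    then show ?thesis by (auto simp: box_def) metis
  qed
  have sub: "box (d + e') UNIV \<subseteq> box d UNIV"
    by (auto simp: box_def lookup_add intro: add_leD1)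
  have U: "(\<Union>j<length ?L. box (fst (?L ! j)) (snd (?L ! j))) =
      box (d + e') (- {i}) \<union> (\<Union>j<length L. box (fst (L ! j)) (snd (L ! j)))"
    by (simp add: lessThan_Suc_eq_insert_0)
  have "(\<Union>j<length ?L. box (fst (?L ! j)) (snd (?L ! j))) = box d UNIV - box (d + e) UNIV"
    unfolding U L(2) using step disj sub by blast
  moreover have "disjoint_family_on (\<lambda>j. box (fst (?L ! j)) (snd (?L ! j))) {..<length ?L}"
  proof -
    have "box (d + e') (- {i}) \<inter> box (fst (L ! j)) (snd (L ! j)) = {}" if "j < length L" for j
      using L(2) step that by blast
    then show ?thesis
      using L(3) unfolding disjoint_family_on_def
      by (auto simp: less_Suc_eq_0_disj nth_Cons split: nat.splits) blast+
  qed
  ultimately show ?case using L(1) Suc(2) by (intro exI[of _ ?L]) simp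
qed

section \<open>Upper bound: partitioning the union of two orthants\<close>

text \<open>The orthant of \<open>a\<close> is one box, and what it leaves of the orthant of
  \<open>b\<close> is cut along a chain from \<open>b\<close> to the lcm. Exchanging
  \<open>a\<close> and \<open>b\<close> gives a second length. The additive equation avoids
  truncated subtraction.\<close>

lemma two_generators_partition:
  fixes a b :: "'n::finite \<Rightarrow>\<^sub>0 nat"
  assumes g: "\<And>i. Poly_Mapping.lookup g i = min (Poly_Mapping.lookup a i) (Poly_Mapping.lookup b i)"
  shows "\<exists>L. length L + deg g = deg a + 1 \<and>
    (\<Union>j<length L. box (fst (L ! j)) (snd (L ! j))) = box a UNIV \<union> box b UNIV \<and>
    disjoint_family_on (\<lambda>j. box (fst (L ! j)) (snd (L ! j))) {..<length L}"
proof -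
  define e where "e = a - g"
  have "a = g + e"
    by (intro poly_mapping_eqI) (simp add: e_def lookup_add lookup_minus g)
  then have dege: "deg g + deg e = deg a" by (metis deg_add)
  \<comment> \<open>At each coordinate b + (a - min a b) = max a b, so \<open>b + e\<close> is the
    exponent of the lcm.\<close>
  have "Poly_Mapping.lookup (b + e) i = max (Poly_Mapping.lookup a i) (Poly_Mapping.lookup b i)" for i
    by (simp add: e_def lookup_add lookup_minus g)
  then have lcm: "box (b + e) UNIV = box a UNIV \<inter> box b UNIV"
    by (auto simp: box_def)
  obtain L where L: "length L = deg e"
    "(\<Union>j<length L. box (fst (L ! j)) (snd (L ! j))) = box b UNIV - box (b + e) UNIV"
    "disjoint_family_on (\<lambda>j. box (fst (L ! j)) (snd (L ! j))) {..<length L}"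
    using box_difference_partition[of e b] by auto
  let ?L = "(a, UNIV) # L"
  have "box a UNIV \<inter> box (fst (L ! j)) (snd (L ! j)) = {}" if "j < length L" for j
    using L(2) lcm that by blast
  then have "disjoint_family_on (\<lambda>j. box (fst (?L ! j)) (snd (?L ! j))) {..<length ?L}"
    using L(3) unfolding disjoint_family_on_def
    by (auto simp: less_Suc_eq_0_disj nth_Cons split: nat.splits) blast+
  moreover have "(\<Union>j<length ?L. box (fst (?L ! j)) (snd (?L ! j))) =
      box a UNIV \<union> (\<Union>j<length L. box (fst (L ! j)) (snd (L ! j)))"
    by (simp add: lessThan_Suc_eq_insert_0)
  ultimately show ?thesis
    using L(1,2) lcm dege by (intro exI[of _ ?L]) auto
qed

section \<open>Lower bound: counting the boxes of an arbitrary partition\<close>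

text \<open>The gaps between the gcd and the apex of the full-dimensional box inject into the
  remaining boxes. The index set \<open>J\<close> is an arbitrary finite set, so that zero summands
  of a decomposition can be left out.\<close>

lemma two_generators_partition_card:
  fixes u v g :: "'n::finite \<Rightarrow>\<^sub>0 nat" and a :: "'j \<Rightarrow> 'n \<Rightarrow>\<^sub>0 nat"
  assumes g: "\<And>i. Poly_Mapping.lookup g i = min (Poly_Mapping.lookup u i) (Poly_Mapping.lookup v i)"
    and J: "finite J"
    and cover: "(\<Union>j\<in>J. box (a j) (Z j)) = box u UNIV \<union> box v UNIV"
    and disj: "disjoint_family_on (\<lambda>j. box (a j) (Z j)) J"
  shows "min (deg u) (deg v) + 1 \<le> card J + deg g"
proof -
  \<comment> \<open>Strictly larger than every coordinate of every apex, so a coordinate of value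
    \<open>N\<close> must be a free direction of its box; also large enough for divisibility by
    either generator.\<close>
  define N where "N = Suc ((\<Sum>j\<in>J. deg (a j)) + deg u + deg v)"
  have le_deg: "Poly_Mapping.lookup c i \<le> deg c" for c :: "'n \<Rightarrow>\<^sub>0 nat" and i
    unfolding deg_def by (rule member_le_sum) auto
  have a_less: "Poly_Mapping.lookup (a j) i < N" if "j \<in> J" for i j
  proof -
    have "deg (a j) \<le> (\<Sum>j\<in>J. deg (a j))" using that J by (intro member_le_sum) auto
    with le_deg[of "a j" i] show ?thesis by (simp add: N_def)
  qed
  have uv: "Poly_Mapping.lookup u i \<le> N" "Poly_Mapping.lookup v i \<le> N" for i
    using le_deg[of u i] le_deg[of v i] by (auto simp: N_def)
  \<comment> \<open>Two full-dimensional boxes share the sum of their apices, so at most one box is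
    full-dimensional.\<close>
  have full_eq: "j = j'" if "j \<in> J" "j' \<in> J" "Z j = UNIV" "Z j' = UNIV" for j j'
  proof (rule ccontr)
    assume "j \<noteq> j'"
    then have "box (a j) UNIV \<inter> box (a j') UNIV = {}"
      using disj that unfolding disjoint_family_on_def by metis
    moreover have "a j + a j' \<in> box (a j) UNIV \<inter> box (a j') UNIV"
      by (simp add: box_def lookup_add)
    ultimately show False by blast
  qed
  obtain t :: "'n \<Rightarrow>\<^sub>0 nat" where t: "\<forall>i. Poly_Mapping.lookup t i = N"
    using exponent_exists[of "\<lambda>_. N"] ..
  have "t \<in> box u UNIV" using uv by (simp add: box_def t)
  then obtain j0 where j0: "j0 \<in> J" "t \<in> box (a j0) (Z j0)" using cover by blast
  have Z0: "Z j0 = UNIV"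
    using j0 a_less[OF j0(1)] by (fastforce simp: box_def t)
  \<comment> \<open>Each pair \<open>(i, k)\<close> stands for the monomial with exponent
    \<open>k\<close> at \<open>i\<close> and \<open>N\<close> elsewhere, which the box of
    \<open>j0\<close> misses because \<open>k\<close> is below its apex.\<close>
  define P where "P = (SIGMA i:UNIV. {Poly_Mapping.lookup g i..<Poly_Mapping.lookup (a j0) i})"
  have "\<exists>j\<in>J - {j0}. Z j = - {i} \<and> Poly_Mapping.lookup (a j) i = k" if "(i, k) \<in> P" for i k
  proof -
    have k: "Poly_Mapping.lookup g i \<le> k" "k < Poly_Mapping.lookup (a j0) i"
      using that by (auto simp: P_def)
    obtain s where s: "\<forall>l. Poly_Mapping.lookup s l = (if l = i then k else N)"
      using exponent_exists[of "\<lambda>l. if l = i then k else N"] ..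
    \<comment> \<open>The generator whose exponent at \<open>i\<close> is the smaller one divides
      this monomial.\<close>
    have "s \<in> box u UNIV \<union> box v UNIV"
      using k(1) uv by (auto simp: box_def s g min_def split: if_splits)
    then obtain j where j: "j \<in> J" "s \<in> box (a j) (Z j)" using cover by blast
    have "Poly_Mapping.lookup (a j) i \<le> Poly_Mapping.lookup s i" using j(2) by (simp add: box_def)
    then have ne: "j \<noteq> j0" using k(2) s by auto
    have others: "l \<in> Z j" if l: "l \<noteq> i" for l
    proof (rule ccontr)
      assume "l \<notin> Z j"
      then have "Poly_Mapping.lookup (a j) l = Poly_Mapping.lookup s l" using j(2) by (simp add: box_def)
      then show False using a_less[OF j(1), of l] s l by simp
    qed
    \<comment> \<open>Otherwise \<open>Z j\<close> would be everything, making \<open>j\<close> a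
      second full-dimensional box.\<close>
    have i: "i \<notin> Z j"
    proof
      assume "i \<in> Z j"
      then have "l \<in> Z j" for l using others by (cases "l = i") auto
      then have "Z j = UNIV" by auto
      then show False using full_eq j(1) j0(1) Z0 ne by blast
    qed
    then have "Poly_Mapping.lookup (a j) i = Poly_Mapping.lookup s i" using j(2) by (simp add: box_def)
    then have "Poly_Mapping.lookup (a j) i = k" using s by simp
    moreover have "Z j = - {i}" using others i by auto
    ultimately show ?thesis using j(1) ne by blast
  qed
  then have "\<forall>p\<in>P. \<exists>j. j \<in> J - {j0} \<and> Z j = - {fst p} \<and> Poly_Mapping.lookup (a j) (fst p) = snd p"
    by fastforce
  then obtain \<phi> where \<phi>: "\<And>p. p \<in> P \<Longrightarrow>
      \<phi> p \<in> J - {j0} \<and> Z (\<phi> p) = - {fst p} \<and> Poly_Mapping.lookup (a (\<phi> p)) (fst p) = snd p"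
    by metis
  \<comment> \<open>The missing direction in \<open>Z\<close> recovers \<open>i\<close>, and then
    the apex coordinate there recovers \<open>k\<close>.\<close>
  have "inj_on \<phi> P"
  proof (rule inj_onI)
    fix p q assume pq: "p \<in> P" "q \<in> P" "\<phi> p = \<phi> q"
    then have "- {fst p} = - {fst q}" using \<phi> by metis
    then have "fst p = fst q" by auto
    moreover from this have "snd p = snd q" using \<phi>[OF pq(1)] \<phi>[OF pq(2)] pq(3) by simp
    ultimately show "p = q" by (rule prod_eqI)
  qed
  moreover have "\<phi> ` P \<subseteq> J - {j0}" using \<phi> by blast
  ultimately have "card P \<le> card (J - {j0})" using J by (intro card_inj_on_le) auto
  moreover have "card J = card (J - {j0}) + 1" using card.remove[OF J j0(1)] by simp
  moreover have "card P = (\<Sum>i\<in>UNIV. Poly_Mapping.lookup (a j0) i - Poly_Mapping.lookup g i)"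
    by (simp add: P_def)
  \<comment> \<open>Termwise x \<le> (x - y) + y, which also holds for truncated
    subtraction.\<close>
  moreover have "deg (a j0) \<le> (\<Sum>i\<in>UNIV. Poly_Mapping.lookup (a j0) i - Poly_Mapping.lookup g i) + deg g"
    unfolding deg_def sum.distrib[symmetric] by (rule sum_mono) simp
  moreover have "min (deg u) (deg v) \<le> deg (a j0)"
  proof -
    have "a j0 \<in> box u UNIV \<union> box v UNIV" using cover j0(1) apex_in_box by blast
    then show ?thesis using deg_mono by fastforce
  qed
  ultimately show ?thesis by linarith
qed

section \<open>Polynomials supported on a set of exponent vectors\<close>

text \<open>The K-span of the monomials with exponents in \<open>A\<close>. Monomial ideals and
  Stanley spaces of homogeneous elements all have this form, which reduces statements about them to
  set theory.\<close>

definition supported :: "('n \<Rightarrow>\<^sub>0 nat) set \<Rightarrow> ('n, 'k::field) mpoly set" where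
  "supported A = {p. Poly_Mapping.keys p \<subseteq> A}"

lemma lookup_times_single_add:
  fixes r :: "('n, 'k::field) mpoly"
  shows "Poly_Mapping.lookup (r * Poly_Mapping.single a c) (b + a) = Poly_Mapping.lookup r b * c"
proof -
  have "r * Poly_Mapping.single a c = (r * Poly_Mapping.single 0 c) * Poly_Mapping.single a 1"
    by (simp add: mult.assoc mult_single)
  moreover have "Poly_Mapping.lookup (r * Poly_Mapping.single 0 c) (b + 0) = Poly_Mapping.lookup r b * c"
    by (subst lookup_mult_unique) (auto split: if_splits)
  ultimately show ?thesis by (simp add: lookup_times_single)
qed

text \<open>Homogeneous elements are terms with an arbitrary coefficient, hence the general
  \<open>c\<close>. For the converse inclusion each term supported on the box is divided by the
  generator separately.\<close>

lemma times_single_image_polys_in: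
  fixes a :: "'n \<Rightarrow>\<^sub>0 nat" and c :: "'k::field"
  assumes "c \<noteq> 0"
  shows "(\<lambda>p. p * Poly_Mapping.single a c) ` polys_in Z = supported (box a Z)"
proof (intro set_eqI iffI)
  fix p assume "p \<in> (\<lambda>p. p * Poly_Mapping.single a c) ` polys_in Z"
  then obtain q where q: "p = q * Poly_Mapping.single a c" "q \<in> polys_in Z" by auto
  then show "p \<in> supported (box a Z)"
    using keys_mult[of q "Poly_Mapping.single a c"]
    by (fastforce simp: supported_def polys_in_def box_iff_add split: if_splits)
next
  fix p :: "('n, 'k) mpoly" assume p: "p \<in> supported (box a Z)"
  have "\<exists>q\<in>polys_in Z. Poly_Mapping.single b (Poly_Mapping.lookup p b) = q * Poly_Mapping.single a c"
    if b: "b \<in> Poly_Mapping.keys p" for b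
  proof -
    obtain d where "Poly_Mapping.keys d \<subseteq> Z" "b = d + a"
      using p b box_iff_add[of b a Z] unfolding supported_def by blast
    then show ?thesis using assms
      by (intro bexI[of _ "Poly_Mapping.single d (Poly_Mapping.lookup p b / c)"])
        (auto simp: mult_single polys_in_def)
  qed
  then obtain q where q: "\<And>b. b \<in> Poly_Mapping.keys p \<Longrightarrow> q b \<in> polys_in Z"
    "\<And>b. b \<in> Poly_Mapping.keys p \<Longrightarrow>
      Poly_Mapping.single b (Poly_Mapping.lookup p b) = q b * Poly_Mapping.single a c"
    by metis
  have "p = (\<Sum>b\<in>Poly_Mapping.keys p. q b * Poly_Mapping.single a c)"
    using poly_eq_sum_terms[of p] q(2) by (metis (no_types, lifting) sum.cong)
  also have "\<dots> = (\<Sum>b\<in>Poly_Mapping.keys p. q b) * Poly_Mapping.single a c"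
    by (simp add: sum_distrib_right)
  finally have "p = (\<Sum>b\<in>Poly_Mapping.keys p. q b) * Poly_Mapping.single a c" .
  moreover have "(\<Sum>b\<in>Poly_Mapping.keys p. q b) \<in> polys_in Z"
    using q(1) keys_sum[of q "Poly_Mapping.keys p"] unfolding polys_in_def by blast
  ultimately show "p \<in> (\<lambda>p. p * Poly_Mapping.single a c) ` polys_in Z" by blast
qed

text \<open>The generator is a one-element basis; independence is cancellation of a nonzero
  term.\<close>

lemma free_over_polys_in:
  fixes c :: "'k::field"
  assumes "c \<noteq> 0"
  shows "free_over (*) (polys_in Z) ((\<lambda>p. p * Poly_Mapping.single a c) ` polys_in Z)"
proof -
  let ?m = "Poly_Mapping.single a c"
  have 0: "0 \<in> polys_in Z" by (simp add: polys_in_def)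
  have cancel: "q = 0" if "q * ?m = 0" for q
    using that assms lookup_times_single_add[of q a c]
    by (intro poly_mapping_eqI) (metis lookup_zero mult_eq_0_iff)
  have "(\<lambda>p. p * ?m) ` polys_in Z =
      {\<Sum>b\<in>T. f b * b | T f. finite T \<and> T \<subseteq> {?m} \<and> (\<forall>b\<in>T. f b \<in> polys_in Z)}"
  proof (intro set_eqI iffI)
    fix p assume "p \<in> (\<lambda>p. p * ?m) ` polys_in Z"
    then obtain q where "p = q * ?m" "q \<in> polys_in Z" by auto
    then show "p \<in> {\<Sum>b\<in>T. f b * b | T f. finite T \<and> T \<subseteq> {?m} \<and> (\<forall>b\<in>T. f b \<in> polys_in Z)}"
      by (auto intro!: exI[of _ "{?m}"] exI[of _ "\<lambda>_. q"])
  next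
    fix p assume "p \<in> {\<Sum>b\<in>T. f b * b | T f. finite T \<and> T \<subseteq> {?m} \<and> (\<forall>b\<in>T. f b \<in> polys_in Z)}"
    then obtain T f where "p = (\<Sum>b\<in>T. f b * b)" "T = {} \<or> T = {?m}" "\<forall>b\<in>T. f b \<in> polys_in Z"
      by (auto simp: subset_singleton_iff)
    then show "p \<in> (\<lambda>p. p * ?m) ` polys_in Z"
      using 0 by (auto intro: rev_image_eqI)
  qed
  moreover have "\<forall>T f. finite T \<and> T \<subseteq> {?m} \<and> (\<forall>b\<in>T. f b \<in> polys_in Z) \<and> (\<Sum>b\<in>T. f b * b) = 0
      \<longrightarrow> (\<forall>b\<in>T. f b = 0)"
    using cancel by (auto simp: subset_singleton_iff)
  ultimately show ?thesis unfolding free_over_def by blast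
qed

lemma internal_direct_sum_cong:
  assumes "\<And>j. j \<in> J \<Longrightarrow> N j = N' j"
  shows "internal_direct_sum M J N \<longleftrightarrow> internal_direct_sum M J N'"
proof -
  \<comment> \<open>With \<open>Q\<close> trivial this serves the spanning half of the definition,
    with \<open>Q\<close> the vanishing of the sum the independence half.\<close>
  have "F \<subseteq> J \<and> (\<forall>j\<in>F. v j \<in> N j) \<and> Q \<longleftrightarrow> F \<subseteq> J \<and> (\<forall>j\<in>F. v j \<in> N' j) \<and> Q" for F v Q
    using assms by blast
  from this this[where Q = True] show ?thesis unfolding internal_direct_sum_def by simp
qed

text \<open>Spanning amounts to covering and independence to disjointness, because the monomials
  form a K-basis.\<close>

lemma internal_direct_sum_supported_iff:
  "internal_direct_sum (supported A :: ('n, 'k::field) mpoly set) J (\<lambda>j. supported (B j)) \<longleftrightarrow>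
    (\<Union>j\<in>J. B j) = A \<and> disjoint_family_on B J"
  (is "internal_direct_sum ?M J ?N \<longleftrightarrow> _")
proof
  assume sum: "internal_direct_sum ?M J ?N"
  then have M: "?M = {\<Sum>j\<in>F. v j | F v. finite F \<and> F \<subseteq> J \<and> (\<forall>j\<in>F. v j \<in> ?N j)}"
    and indep: "\<And>F v. finite F \<Longrightarrow> F \<subseteq> J \<Longrightarrow> \<forall>j\<in>F. v j \<in> ?N j \<Longrightarrow> sum v F = 0 \<Longrightarrow> \<forall>j\<in>F. v j = 0"
    unfolding internal_direct_sum_def by blast+
  have single: "Poly_Mapping.single b (c::'k) \<in> supported C" if "b \<in> C" for b and C :: "('n \<Rightarrow>\<^sub>0 nat) set" and c
    using that by (simp add: supported_def)
  have "b \<in> (\<Union>j\<in>J. B j)" if "b \<in> A" for b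
  proof -
    have "Poly_Mapping.single b 1 \<in> ?M" using single that .
    then obtain F v where v: "Poly_Mapping.single b (1::'k) = sum v F" "F \<subseteq> J" "\<forall>j\<in>F. v j \<in> ?N j"
      unfolding M by blast
    then have "b \<in> Poly_Mapping.keys (sum v F)" by (metis in_keys_iff lookup_single_eq zero_neq_one)
    then show ?thesis using keys_sum[of v F] v(2,3) by (fastforce simp: supported_def)
  qed
  moreover have "b \<in> A" if "j \<in> J" "b \<in> B j" for b j
  proof -
    have "Poly_Mapping.single b (1::'k) \<in> ?M"
      unfolding M using that single
      by (auto intro!: exI[of _ "{j}"] exI[of _ "\<lambda>_. Poly_Mapping.single b (1::'k)"])
    then show ?thesis by (simp add: supported_def)
  qed
  moreover have "B i \<inter> B j = {}" if "i \<in> J" "j \<in> J" "i \<noteq> j" for i j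
  proof (rule ccontr)
    assume "B i \<inter> B j \<noteq> {}"
    then obtain b where b: "b \<in> B i" "b \<in> B j" by blast
    \<comment> \<open>A shared exponent gives the relation x^b - x^b = 0 between two
      summands.\<close>
    let ?v = "\<lambda>l. Poly_Mapping.single b (if l = i then 1 else - 1 :: 'k)"
    have "sum ?v {i, j} = 0" using that(3) by (simp flip: single_add)
    then have "\<forall>l\<in>{i, j}. ?v l = 0"
      using that b single by (intro indep) auto
    then show False by (metis insertI1 lookup_single_eq lookup_zero zero_neq_one)
  qed
  ultimately show "(\<Union>j\<in>J. B j) = A \<and> disjoint_family_on B J"
    unfolding disjoint_family_on_def by blast
next
  assume *: "(\<Union>j\<in>J. B j) = A \<and> disjoint_family_on B J"
  show "internal_direct_sum ?M J ?N"
    unfolding internal_direct_sum_def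
  proof (intro conjI set_eqI iffI allI impI ballI)
    fix p :: "('n, 'k) mpoly" assume p: "p \<in> ?M"
    then have "\<forall>b\<in>Poly_Mapping.keys p. \<exists>j\<in>J. b \<in> B j" using * by (auto simp: supported_def)
    then obtain h where h: "\<And>b. b \<in> Poly_Mapping.keys p \<Longrightarrow> h b \<in> J \<and> b \<in> B (h b)" by metis
    \<comment> \<open>The terms of \<open>p\<close> are sorted by the chosen index
      \<open>h b\<close> of a set containing their exponent.\<close>
    define v where "v = (\<lambda>j. \<Sum>b | b \<in> Poly_Mapping.keys p \<and> h b = j.
      Poly_Mapping.single b (Poly_Mapping.lookup p b))"
    have "p = sum v (h ` Poly_Mapping.keys p)"
      using poly_eq_sum_terms[of p]
        sum.image_gen[of "Poly_Mapping.keys p" "\<lambda>b. Poly_Mapping.single b (Poly_Mapping.lookup p b)" h]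
      by (simp add: v_def)
    moreover have "v j \<in> ?N j" for j
      using h keys_sum[of "\<lambda>b. Poly_Mapping.single b (Poly_Mapping.lookup p b)"]
      by (fastforce simp: v_def supported_def split: if_splits)
    ultimately show "p \<in> {\<Sum>j\<in>F. v j | F v. finite F \<and> F \<subseteq> J \<and> (\<forall>j\<in>F. v j \<in> ?N j)}"
      using h by (intro CollectI exI[of _ "h ` Poly_Mapping.keys p"] exI[of _ v]) auto
  next
    fix p :: "('n, 'k) mpoly"
    assume "p \<in> {\<Sum>j\<in>F. v j | F v. finite F \<and> F \<subseteq> J \<and> (\<forall>j\<in>F. v j \<in> ?N j)}"
    then obtain F v where v: "p = sum v F" "F \<subseteq> J" "\<forall>j\<in>F. v j \<in> ?N j" by blast
    then show "p \<in> ?M" using keys_sum[of v F] * by (fastforce simp: supported_def)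
  next
    fix F and v :: "_ \<Rightarrow> ('n, 'k) mpoly" and j
    assume v: "finite F \<and> F \<subseteq> J \<and> (\<forall>j\<in>F. v j \<in> ?N j) \<and> sum v F = 0" and j: "j \<in> F"
    show "v j = 0"
    proof (rule poly_mapping_eqI)
      fix b
      show "Poly_Mapping.lookup (v j) b = Poly_Mapping.lookup 0 b"
      proof (cases "b \<in> B j")
        case True
        \<comment> \<open>By disjointness only the summand \<open>j\<close> can contribute to the
          coefficient at \<open>b\<close>.\<close>
        have "Poly_Mapping.lookup (v l) b = 0" if "l \<in> F - {j}" for l
        proof -
          have "B l \<inter> B j = {}" using * v j that unfolding disjoint_family_on_def by blast
          moreover have "Poly_Mapping.keys (v l) \<subseteq> B l" using v that by (simp add: supported_def)
          ultimately show ?thesis using True by (auto simp flip: not_in_keys_iff_lookup_eq_zero)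
        qed
        then have "(\<Sum>l\<in>F. Poly_Mapping.lookup (v l) b) = Poly_Mapping.lookup (v j) b"
          using v j by (simp add: sum.remove)
        then show ?thesis using v by (metis lookup_sum)
      next
        case False
        moreover have "Poly_Mapping.keys (v j) \<subseteq> B j" using v j by (simp add: supported_def)
        ultimately show ?thesis by (auto simp flip: not_in_keys_iff_lookup_eq_zero)
      qed
    qed
  qed
qed

section \<open>Monomial ideals and homogeneous elements through their exponents\<close>

text \<open>A monomial lies in the ideal exactly when some generator divides it.\<close>

lemma span_monomials:
  "ideal.span ((\<lambda>a. Poly_Mapping.single a (1::'k::field)) ` E) = supported (\<Union>a\<in>E. box a UNIV)"
    (is "ideal.span ?G = ?R")
proof (intro set_eqI iffI)
  fix p assume "p \<in> ideal.span ?G"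
  then show "p \<in> ?R"
  proof (induction rule: ideal.span_induct_alt)
    case base
    then show ?case by (simp add: supported_def)
  next
    case (step c x y)
    then obtain a where a: "x = Poly_Mapping.single a 1" "a \<in> E" by blast
    have "c * x \<in> supported (box a UNIV)"
      using times_single_image_polys_in[of "1::'k" a UNIV] by (auto simp: a polys_in_def)
    then show ?case
      using step(2) a(2) Poly_Mapping.keys_add[of "c * x" y] by (fastforce simp: supported_def)
  qed
next
  fix p assume p: "p \<in> ?R"
  have "Poly_Mapping.single b (Poly_Mapping.lookup p b) \<in> ideal.span ?G"
    if b: "b \<in> Poly_Mapping.keys p" for b
  proof -
    obtain a where "a \<in> E" "b \<in> box a UNIV" using p b by (auto simp: supported_def)
    then obtain d where a: "a \<in> E" "b = d + a" by (auto simp: box_iff_add)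
    have "Poly_Mapping.single d (Poly_Mapping.lookup p b) * Poly_Mapping.single a 1 \<in> ideal.span ?G"
      using a(1) by (intro ideal.span_scale ideal.span_base) auto
    then show ?thesis using a(2) by (simp add: mult_single)
  qed
  then show "p \<in> ideal.span ?G"
    using poly_eq_sum_terms[of p] ideal.span_sum by (metis (no_types, lifting))
qed

text \<open>The degree determines the exponent, so each graded component is at most one-dimensional;
  the zero element is covered by the coefficient 0.\<close>

lemma ideal_comp_single:
  assumes "m \<in> ideal_comp I \<alpha>"
  shows "\<exists>a c. m = Poly_Mapping.single a c"
proof (cases "m = 0")
  case True
  then show ?thesis by (metis single_zero)
next
  case False
  then obtain a where a: "a \<in> Poly_Mapping.keys m" by fastforce
  have "b = a" if "b \<in> Poly_Mapping.keys m" for b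
  proof (rule poly_mapping_eqI)
    fix i
    have "(\<lambda>i. int (Poly_Mapping.lookup b i)) = (\<lambda>i. int (Poly_Mapping.lookup a i))"
      using assms a that by (simp add: ideal_comp_def)
    then show "Poly_Mapping.lookup b i = Poly_Mapping.lookup a i" by (metis of_nat_eq_iff)
  qed
  then have "Poly_Mapping.keys m = {a}" using a by blast
  then show ?thesis using poly_eq_sum_terms[of m] by auto
qed

lemma total_degree_single: "total_degree (Poly_Mapping.single a (1::'k::field)) = deg a"
  by (simp add: total_degree_def deg_def)

section \<open>Stanley decompositions of an ideal generated by two monomials\<close>

context
  fixes I :: "('n::finite, 'k::field) mpoly set" and A
  assumes graded: "fg_multigraded_module (*) I (ideal_comp I)"
    and I: "I = supported A"
begin

interpretation I: fg_multigraded_module "(*)" I "ideal_comp I"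
  by (fact graded)

text \<open>Each box with apex \<open>a\<close> and directions \<open>Z\<close> becomes the summand
  x^a K[Z], so the number of boxes is the length of the decomposition.\<close>

lemma stanley_decomposition_of_boxes:
  assumes cover: "(\<Union>j<length L. box (fst (L ! j)) (snd (L ! j))) = A"
    and disj: "disjoint_family_on (\<lambda>j. box (fst (L ! j)) (snd (L ! j))) {..<length L}"
  shows "I.stanley_decomposition (map (\<lambda>(a, Z). (Poly_Mapping.single a 1, Z)) L)"
    (is "I.stanley_decomposition ?D")
proof -
  have space: "I.stanley_space (Poly_Mapping.single a 1) Z = supported (box a Z)" for a Z
    unfolding I.stanley_space_def by (simp add: times_single_image_polys_in)
  have "m \<in> I \<and> (\<exists>\<alpha>. m \<in> ideal_comp I \<alpha>) \<and> free_over (*) (polys_in Z) (I.stanley_space m Z)"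
    if mZ: "(m, Z) \<in> set ?D" for m Z
  proof -
    obtain a where a: "(a, Z) \<in> set L" "m = Poly_Mapping.single a 1" using mZ by auto
    then obtain j where "j < length L" "L ! j = (a, Z)" by (auto simp: in_set_conv_nth)
    then have "a \<in> A" using apex_in_box[of a Z] cover by force
    then have "m \<in> I" by (simp add: I a(2) supported_def)
    moreover from this have "m \<in> ideal_comp I (\<lambda>i. int (Poly_Mapping.lookup a i))"
      by (simp add: ideal_comp_def a(2))
    moreover have "free_over (*) (polys_in Z) (I.stanley_space m Z)"
      unfolding I.stanley_space_def a(2) by (rule free_over_polys_in) simp
    ultimately show ?thesis by blast
  qed
  moreover have "internal_direct_sum I {..<length ?D} (\<lambda>j. I.stanley_space (fst (?D ! j)) (snd (?D ! j)))"
  proof -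
    have "internal_direct_sum I {..<length L} (\<lambda>j. supported (box (fst (L ! j)) (snd (L ! j))))"
      unfolding I internal_direct_sum_supported_iff using cover disj by blast
    moreover have "I.stanley_space (fst (?D ! j)) (snd (?D ! j)) = supported (box (fst (L ! j)) (snd (L ! j)))"
      if "j \<in> {..<length L}" for j
      using that space by (simp add: case_prod_beta)
    ultimately show ?thesis
      unfolding length_map using internal_direct_sum_cong by (metis (no_types, lifting))
  qed
  ultimately show ?thesis unfolding I.stanley_decomposition_def by blast
qed

text \<open>A summand \<open>mK[Z]\<close> with \<open>m = 0\<close> is allowed and contributes no box, hence the index set \<open>J\<close>.\<close>

lemma boxes_of_stanley_decomposition:
  assumes D: "I.stanley_decomposition D"
  obtains J a Z where "J \<subseteq> {..<length D}" "(\<Union>j\<in>J. box (a j) (Z j)) = A"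
    "disjoint_family_on (\<lambda>j. box (a j) (Z j)) J"
proof -
  let ?N = "\<lambda>j. I.stanley_space (fst (D ! j)) (snd (D ! j))"
  have "\<exists>a c. fst (D ! j) = Poly_Mapping.single a c" if "j < length D" for j
  proof -
    have "(fst (D ! j), snd (D ! j)) \<in> set D" using that by simp
    then show ?thesis using D ideal_comp_single unfolding I.stanley_decomposition_def by blast
  qed
  then obtain a c where ac: "\<And>j. j < length D \<Longrightarrow> fst (D ! j) = Poly_Mapping.single (a j) (c j)"
    by metis
  let ?Z = "\<lambda>j. snd (D ! j)"
  \<comment> \<open>A zero generator spans the zero space, which is the space supported on the empty
    set.\<close>
  let ?B = "\<lambda>j. if c j = 0 then {} else box (a j) (?Z j)"
  have N: "?N j = supported (?B j)" if "j \<in> {..<length D}" for j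
  proof (cases "c j = 0")
    case True
    have "0 \<in> polys_in (?Z j)" by (simp add: polys_in_def)
    then show ?thesis
      using True ac that by (auto simp: I.stanley_space_def supported_def)
  next
    case False
    then show ?thesis
      using ac that by (simp add: I.stanley_space_def times_single_image_polys_in)
  qed
  have "internal_direct_sum I {..<length D} ?N"
    using D unfolding I.stanley_decomposition_def by blast
  then have "internal_direct_sum I {..<length D} (\<lambda>j. supported (?B j))"
    by (rule iffD1[OF internal_direct_sum_cong, rotated]) (rule N)
  then have B: "(\<Union>j<length D. ?B j) = A" "disjoint_family_on ?B {..<length D}"
    unfolding I internal_direct_sum_supported_iff by (rule conjunct1, rule conjunct2)
  let ?J = "{j. j < length D \<and> c j \<noteq> 0}"
  show thesis
  proof (rule that)
    show "?J \<subseteq> {..<length D}" by auto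
    show "(\<Union>j\<in>?J. box (a j) (?Z j)) = A" using B(1) by (auto split: if_splits)
    have "disjoint_family_on ?B ?J"
      by (rule disjoint_family_on_mono[OF _ B(2)]) auto
    then show "disjoint_family_on (\<lambda>j. box (a j) (?Z j)) ?J"
      by (simp add: disjoint_family_on_def)
  qed
qed

end

section \<open>The two bounds combined into the Stanley length\<close>

theorem theorem3p9:
  fixes I :: "('n::finite, 'k::field) mpoly set"
    and u\<^sub>1 u\<^sub>2 :: "('n, 'k) mpoly"
  assumes "monomial_ideal I"
    and "is_monomial u\<^sub>1" and "is_monomial u\<^sub>2" and "u\<^sub>1 \<noteq> u\<^sub>2"
    and "minimally_generates {u\<^sub>1, u\<^sub>2} I"
  shows "int (ideal_slength I) =
    int (min (total_degree u\<^sub>1) (total_degree u\<^sub>2)) - int (total_degree (monomial_gcd u\<^sub>1 u\<^sub>2)) + 1"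
proof -
  obtain a b where u: "u\<^sub>1 = Poly_Mapping.single a 1" "u\<^sub>2 = Poly_Mapping.single b 1"
    using assms(2,3) by (auto simp: is_monomial_def)
  obtain g where "\<forall>i. Poly_Mapping.lookup g i = min (Poly_Mapping.lookup a i) (Poly_Mapping.lookup b i)"
    using exponent_exists ..
  note g = this[rule_format]
  have gcd: "monomial_gcd u\<^sub>1 u\<^sub>2 = Poly_Mapping.single g 1"
    unfolding u by (rule monomial_gcd_single) (rule g)
  have span: "ideal.span {u\<^sub>1, u\<^sub>2} = I" using assms(5) by (simp add: minimally_generates_def)
  then have I: "I = supported (box a UNIV \<union> box b UNIV)"
    using span_monomials[of "{a, b}", where 'k = 'k] by (simp add: u)
  have graded: "fg_multigraded_module (*) I (ideal_comp I)"
    using assms(1) span by (intro monomial_ideal_multigraded[of I "{u\<^sub>1, u\<^sub>2}"]) auto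
  interpret fg_multigraded_module "(*)" I "ideal_comp I" by (fact graded)
  let ?S = "{length D | D. stanley_decomposition D}"
  have S_I: "length L \<in> ?S"
    if "(\<Union>j<length L. box (fst (L ! j)) (snd (L ! j))) = box a UNIV \<union> box b UNIV"
      "disjoint_family_on (\<lambda>j. box (fst (L ! j)) (snd (L ! j))) {..<length L}" for L
    using stanley_decomposition_of_boxes[OF graded I that] by force
  \<comment> \<open>Taking the generators in either order gives decompositions of both lengths; the
    shorter one attains the minimum.\<close>
  obtain L\<^sub>1 where L1: "length L\<^sub>1 + deg g = deg a + 1"
    "(\<Union>j<length L\<^sub>1. box (fst (L\<^sub>1 ! j)) (snd (L\<^sub>1 ! j))) = box a UNIV \<union> box b UNIV"
    "disjoint_family_on (\<lambda>j. box (fst (L\<^sub>1 ! j)) (snd (L\<^sub>1 ! j))) {..<length L\<^sub>1}"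
    using two_generators_partition[OF g] by blast
  obtain L\<^sub>2 where L2: "length L\<^sub>2 + deg g = deg b + 1"
    "(\<Union>j<length L\<^sub>2. box (fst (L\<^sub>2 ! j)) (snd (L\<^sub>2 ! j))) = box b UNIV \<union> box a UNIV"
    "disjoint_family_on (\<lambda>j. box (fst (L\<^sub>2 ! j)) (snd (L\<^sub>2 ! j))) {..<length L\<^sub>2}"
    using two_generators_partition[of g b a] g by (auto simp: min.commute)
  have L1_S: "length L\<^sub>1 \<in> ?S" by (rule S_I[OF L1(2,3)])
  have L2_S: "length L\<^sub>2 \<in> ?S" by (rule S_I[OF L2(2)[unfolded Un_commute[of "box b UNIV"]] L2(3)])
  have lower: "min (deg a) (deg b) + 1 \<le> n + deg g" if "n \<in> ?S" for n
  proof -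
    obtain D where D: "n = length D" "stanley_decomposition D" using \<open>n \<in> ?S\<close> by blast
    obtain J x Z where J: "J \<subseteq> {..<length D}"
      "(\<Union>j\<in>J. box (x j) (Z j)) = box a UNIV \<union> box b UNIV"
      "disjoint_family_on (\<lambda>j. box (x j) (Z j)) J"
      by (rule boxes_of_stanley_decomposition[OF graded I D(2)])
    have "card J \<le> n" using card_mono[OF _ J(1)] D(1) by simp
    moreover have "min (deg a) (deg b) + 1 \<le> card J + deg g"
      using J finite_subset by (intro two_generators_partition_card[OF g _ J(2,3)]) blast
    ultimately show ?thesis by linarith
  qed
  \<comment> \<open>The set of lengths is nonempty, so its infimum is attained and the default value
    0 for an empty set does not arise.\<close>
  have "slength \<in> ?S" unfolding slength_def using L1_S by (intro Inf_nat_def1) blast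
  moreover have "slength \<le> length L\<^sub>1" "slength \<le> length L\<^sub>2"
    unfolding slength_def using L1_S L2_S by (simp_all add: cInf_lower)
  ultimately have "slength + deg g = min (deg a) (deg b) + 1"
    using lower[of slength] L1(1) L2(1) by linarith
  then show ?thesis unfolding gcd unfolding u total_degree_single by linarith
qed

end
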